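(* Let $0<\varepsilon<1/2$. There exists a function $\tau:\mathbb{R}^2\to(-\varepsilon,\varepsilon)$ such that for every sequence $(x_n,y_n)_{n\in\mathbb{N}}$ in $\mathbb{R}^2$: if the sequence $(y_n-\varepsilon|x_n|)_n$ is bounded below and if $y_{n+1}-y_n\leqslant \tau(x_n,y_n)\,(x_{n+1}-x_n)$ for all $n\in\mathbb{N}$, then the sequence $(x_n,y_n)$ converges in $\mathbb{R}^2$.
   Context: No non-standard notation is used; $(-\varepsilon,\varepsilon)$ denotes the open interval. *)

theory Defs
  imports "HOL-Analysis.Analysis"
begin

end

theory Submission
  imports Defs "HOL-Library.Bourbaki_Witt_Fixpoint"
begin

text \<open>
  Suppose \<open>G\<close> is a family of convex functions, totally ordered pointwise, all \<open>\<theta>\<close>-Lipschitz with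
  \<open>\<theta> < \<epsilon>\<close>. Through every point \<open>(x, y)\<close> there is a line of slope in \<open>(-\<epsilon>, \<epsilon>)\<close> lying below all members
  of \<open>G\<close> that pass above or through \<open>(x, y)\<close>; let \<open>\<tau> (x, y)\<close> be its slope. A sequence as in the theorem that
  is once below (or on) the graph of a member of \<open>G\<close> then stays there. So it suffices to choose \<open>G\<close>
  such that every bounded sequence is eventually trapped between two members of \<open>G\<close> that differ only on
  an arbitrarily short interval, and only by little. Such a family is obtained from the translates
  \<open>\<theta> \<surd>(1 + x\<^sup>2) + i\<close>, \<open>i\<close> an integer, by subdividing the layer between two neighbours \<open>a\<close>, \<open>a'\<close> again and
  again at ever finer scales: a layer is filled by transfinite iteration, pushing \<open>a\<close> upwards towards
  \<open>a'\<close> by small local bumps. At a limit stage of the iteration the sequence may end up on the graph of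
  a single member of \<open>G\<close>; this graph is strictly convex, hence the sequence is constant from then on.
\<close>

section \<open>Strictly convex functions with small slopes\<close>

definition hyp :: "real \<Rightarrow> real" where
  "hyp x = sqrt (1 + x\<^sup>2)"

lemma hyp_ge_1: "1 \<le> hyp x"
  by (simp add: hyp_def)

lemma hyp_le: "hyp x \<le> 1 + \<bar>x\<bar>"
  unfolding hyp_def by (rule real_le_lsqrt) (auto simp: power2_eq_square algebra_simps)

lemma hyp_square: "hyp x * hyp x = 1 + x\<^sup>2"
  by (simp add: hyp_def)

text \<open>\<open>hyp x\<close> is the norm of the vector (1, x), and
  \<open>(1 + a * x) / hyp a\<close> is the tangent of \<open>hyp\<close> at \<open>a\<close>. So
  the gap is a Cauchy-Schwarz defect, made explicit by Lagrange's identity. The uniform quadratic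
  bound later confines bumps to short intervals.\<close>

lemma hyp_tangent_gap:
  assumes "\<bar>a\<bar> \<le> R" "\<bar>x\<bar> \<le> R"
  shows "(x - a)\<^sup>2 / (2 * (1 + R\<^sup>2)\<^sup>2) \<le> hyp x - (1 + a * x) / hyp a"
proof -
  have pa: "hyp a > 0" and px: "hyp x > 0"
    using hyp_ge_1[of a] hyp_ge_1[of x] by auto
  have sq: "(hyp x * hyp a)\<^sup>2 = (1 + a * x)\<^sup>2 + (x - a)\<^sup>2"
    using hyp_square[of a] hyp_square[of x] by algebra
  have le: "\<bar>1 + a * x\<bar> \<le> hyp x * hyp a"
    by (rule power2_le_imp_le) (use sq pa px in auto)
  have bd: "hyp z \<le> 1 + R\<^sup>2" if "\<bar>z\<bar> \<le> R" for z
  proof -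
    have "hyp z \<le> hyp z * hyp z"
      using hyp_ge_1[of z] by (simp add: mult_le_cancel_left1)
    also have "\<dots> \<le> 1 + R\<^sup>2"
      using that by (simp add: hyp_square abs_le_square_iff[symmetric])
    finally show ?thesis .
  qed
  have q2: "hyp z * hyp z \<le> 1 + R\<^sup>2" if "\<bar>z\<bar> \<le> R" for z
    using that by (simp add: hyp_square abs_le_square_iff[symmetric])
  have prod: "hyp x * hyp a \<le> 1 + R\<^sup>2"
  proof -
    have "0 \<le> (hyp x - hyp a)\<^sup>2" by simp
    then show ?thesis
      using q2[OF assms(1)] q2[OF assms(2)] by (simp add: power2_eq_square algebra_simps)
  qed
  \<comment> \<open>The factor \<open>hyp x * hyp a + (1 + a * x)\<close> is at most
    \<open>2 * (1 + R\<^sup>2)\<close>, so the defect is at least a multiple of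
    \<open>(x - a)\<^sup>2\<close>.\<close>
  have "(x - a)\<^sup>2 = (hyp x * hyp a - (1 + a * x)) * (hyp x * hyp a + (1 + a * x))"
    using sq by (simp add: power2_eq_square algebra_simps)
  also have "\<dots> \<le> (hyp x * hyp a - (1 + a * x)) * (2 * (1 + R\<^sup>2))"
    using le prod by (intro mult_left_mono) auto
  finally have 1: "(x - a)\<^sup>2 / (2 * (1 + R\<^sup>2)) \<le> hyp x * hyp a - (1 + a * x)"
    by (simp add: pos_divide_le_eq add_pos_nonneg)
  have "(x - a)\<^sup>2 / (2 * (1 + R\<^sup>2)\<^sup>2) = ((x - a)\<^sup>2 / (2 * (1 + R\<^sup>2))) / (1 + R\<^sup>2)"
    by (simp add: power2_eq_square)
  also have "\<dots> \<le> ((x - a)\<^sup>2 / (2 * (1 + R\<^sup>2))) / hyp a"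
    using bd[OF assms(1)] pa by (intro divide_left_mono) (auto intro!: mult_pos_pos add_pos_nonneg divide_nonneg_nonneg)
  also have "\<dots> \<le> (hyp x * hyp a - (1 + a * x)) / hyp a"
    using 1 pa by (intro divide_right_mono) auto
  also have "\<dots> = hyp x - (1 + a * x) / hyp a"
    using pa by (simp add: field_simps)
  finally show ?thesis .
qed

lemma hyp_tangent_gt:
  assumes "x \<noteq> a"
  shows "(1 + a * x) / hyp a < hyp x"
proof -
  let ?R = "max \<bar>a\<bar> \<bar>x\<bar>"
  have "0 < (x - a)\<^sup>2 / (2 * (1 + ?R\<^sup>2)\<^sup>2)"
    using assms add_pos_nonneg[of 1 "?R\<^sup>2"] by (simp add: zero_less_divide_iff)
  with hyp_tangent_gap[of a ?R x] show ?thesis by simp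
qed

lemma hyp_tangent_eq: "(1 + a * a) / hyp a = hyp a"
proof -
  have "hyp a > 0" using hyp_ge_1[of a] by auto
  then show ?thesis using hyp_square[of a] by (simp add: divide_eq_eq power2_eq_square)
qed

lemma hyp_tangent_ge: "(1 + a * x) / hyp a \<le> hyp x"
  using hyp_tangent_gt[of x a] hyp_tangent_eq[of a] by (cases "x = a") auto

lemma hyp_slope: "\<bar>a / hyp a\<bar> \<le> 1"
proof -
  have "\<bar>a\<bar> \<le> hyp a" unfolding hyp_def by (rule real_le_rsqrt) simp
  then show ?thesis using hyp_ge_1[of a] by simp
qed

lemma hyp_lipschitz: "hyp x - hyp z \<le> \<bar>x - z\<bar>"
proof -
  have "hyp x - hyp z \<le> (1 + x * x) / hyp x - (1 + x * z) / hyp x"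
    using hyp_tangent_ge[of x z] hyp_tangent_eq[of x] by linarith
  also have "\<dots> = x / hyp x * (x - z)"
    by (simp add: diff_divide_distrib[symmetric] algebra_simps)
  also have "\<dots> \<le> \<bar>x / hyp x\<bar> * \<bar>x - z\<bar>"
    by (metis abs_ge_self abs_mult)
  also have "\<dots> \<le> \<bar>x - z\<bar>"
    using hyp_slope[of x] by (intro mult_left_le_one_le) auto
  finally show ?thesis .
qed

lemma hyp_convex: "convex_on UNIV hyp"
proof (rule convex_onI)
  fix t x y :: real
  assume t: "0 < t" "t < 1"
  define a where "a = (1 - t) * x + t * y"
  have "hyp a = (1 + a * a) / hyp a" by (simp add: hyp_tangent_eq)
  also have "\<dots> = (1 - t) * ((1 + a * x) / hyp a) + t * ((1 + a * y) / hyp a)"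
  proof -
    have "1 + a * a = (1 - t) * (1 + a * x) + t * (1 + a * y)"
      unfolding a_def by algebra
    then show ?thesis by (metis add_divide_distrib times_divide_eq_right)
  qed
  also have "\<dots> \<le> (1 - t) * hyp x + t * hyp y"
    using t by (intro add_mono mult_left_mono hyp_tangent_ge) auto
  finally show "hyp ((1 - t) *\<^sub>R x + t *\<^sub>R y) \<le> (1 - t) * hyp x + t * hyp y"
    by (simp add: a_def)
qed simp

lemma hyp_midpoint:
  assumes "x \<noteq> z"
  shows "hyp ((x + z) / 2) < (hyp x + hyp z) / 2"
proof -
  define a where "a = (x + z) / 2"
  have ne: "x \<noteq> a" "z \<noteq> a" using assms by (auto simp: a_def)
  have "1 + a * a = ((1 + a * x) + (1 + a * z)) / 2"
    by (simp add: a_def field_simps)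
  then have "hyp a = ((1 + a * x) / hyp a + (1 + a * z) / hyp a) / 2"
    using hyp_tangent_eq[of a] by (simp add: add_divide_distrib)
  with hyp_tangent_gt[OF ne(1)] hyp_tangent_gt[OF ne(2)] have "hyp a < (hyp x + hyp z) / 2"
    by argo
  then show ?thesis by (simp only: a_def)
qed

section \<open>Admissible functions: convexity reserve and Lipschitz bound\<close>

lemma convex_on_affine: "convex_on UNIV (\<lambda>x::real. u * x + v)"
  by (rule convex_onI) (simp_all add: algebra_simps)

text \<open>
  The summand \<open>c * hyp\<close> is a reserve of strict convexity. It is spent in the course of the construction,
  so \<open>c\<close> decreases; the Lipschitz constant of the remainder is such that \<open>adm \<theta> c\<close> grows as \<open>c\<close> decreases.
\<close>

definition adm :: "real \<Rightarrow> real \<Rightarrow> (real \<Rightarrow> real) \<Rightarrow> bool" where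
  "adm \<theta> c g \<longleftrightarrow> convex_on UNIV (\<lambda>x. g x - c * hyp x) \<and>
     (\<forall>x z. (g x - c * hyp x) - (g z - c * hyp z) \<le> (\<theta> - c) * \<bar>x - z\<bar>)"

text \<open>The released part \<open>(c - d) * hyp\<close> is convex, and its Lipschitz constant
  \<open>c - d\<close> is exactly what \<open>\<theta> - d\<close> gains over
  \<open>\<theta> - c\<close>.\<close>

lemma adm_antimono:
  assumes "adm \<theta> c g" "d \<le> c"
  shows "adm \<theta> d g"
  unfolding adm_def
proof (intro conjI allI)
  have "convex_on UNIV (\<lambda>x. (g x - c * hyp x) + (c - d) * hyp x)"
    using assms by (intro convex_on_add convex_on_cmul hyp_convex) (auto simp: adm_def)
  then show "convex_on UNIV (\<lambda>x. g x - d * hyp x)"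
    by (simp add: algebra_simps)
  fix x z
  have "(g x - c * hyp x) - (g z - c * hyp z) \<le> (\<theta> - c) * \<bar>x - z\<bar>"
    using assms by (auto simp: adm_def)
  moreover have "(c - d) * (hyp x - hyp z) \<le> (c - d) * \<bar>x - z\<bar>"
    using assms hyp_lipschitz by (intro mult_left_mono) auto
  ultimately show "(g x - d * hyp x) - (g z - d * hyp z) \<le> (\<theta> - d) * \<bar>x - z\<bar>"
    by (simp add: algebra_simps)
qed

lemma adm_lipschitz:
  assumes "adm \<theta> c g" "0 \<le> c"
  shows "g x - g z \<le> \<theta> * \<bar>x - z\<bar>"
proof -
  have "adm \<theta> 0 g" using adm_antimono assms by blast
  then show ?thesis by (simp add: adm_def)
qed

lemma adm_convex:
  assumes "adm \<theta> c g" "0 \<le> c"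
  shows "convex_on UNIV g"
proof -
  have "adm \<theta> 0 g" using adm_antimono assms by blast
  then show ?thesis by (simp add: adm_def)
qed

lemma adm_continuous:
  assumes "adm \<theta> c g" "0 \<le> c"
  shows "continuous_on S g"
proof -
  have "continuous_on UNIV g"
    by (rule convex_on_continuous[OF open_UNIV adm_convex[OF assms]])
  then show ?thesis by (rule continuous_on_subset) simp
qed

lemma adm_midpoint:
  assumes "adm \<theta> c g" "0 < c" "x \<noteq> z"
  shows "g ((x + z) / 2) < (g x + g z) / 2"
proof -
  have "convex_on UNIV (\<lambda>x. g x - c * hyp x)"
    using assms by (simp add: adm_def)
  from convex_onD[OF this, of "1/2" x z]
  have "g ((x + z) / 2) - c * hyp ((x + z) / 2) \<le> (g x - c * hyp x + (g z - c * hyp z)) / 2"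
    by (simp add: field_simps)
  moreover have "c * hyp ((x + z) / 2) < c * ((hyp x + hyp z) / 2)"
    using assms hyp_midpoint by simp
  ultimately show ?thesis by (simp add: field_simps)
qed

text \<open>Both conditions bound \<open>f\<close> at one point by an expression monotone in the
  values of \<open>f\<close> elsewhere, so they survive pointwise suprema. This serves the limit
  stages of the iteration.\<close>

lemma adm_Sup:
  assumes M: "M \<noteq> {}" "\<And>f. f \<in> M \<Longrightarrow> adm \<theta> c f"
    and bdd: "\<And>x. bdd_above ((\<lambda>f. f x) ` M)"
  shows "adm \<theta> c (\<lambda>x. SUP f\<in>M. f x)"
proof -
  let ?s = "\<lambda>x. SUP f\<in>M. f x"
  have up: "f x \<le> ?s x" if "f \<in> M" for f x
    using that bdd by (intro cSUP_upper)
  show ?thesis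
    unfolding adm_def
  proof (intro conjI allI)
    show "convex_on UNIV (\<lambda>x. ?s x - c * hyp x)"
    proof (rule convex_onI)
      fix t x y :: real
      assume t: "0 < t" "t < 1"
      let ?w = "(1 - t) *\<^sub>R x + t *\<^sub>R y"
      have "?s ?w \<le> (1 - t) * (?s x - c * hyp x) + t * (?s y - c * hyp y) + c * hyp ?w"
      proof (rule cSUP_least[OF M(1)])
        fix f assume f: "f \<in> M"
        have "f ?w - c * hyp ?w \<le> (1 - t) * (f x - c * hyp x) + t * (f y - c * hyp y)"
          using M(2)[OF f] t unfolding adm_def by (intro convex_onD) auto
        also have "\<dots> \<le> (1 - t) * (?s x - c * hyp x) + t * (?s y - c * hyp y)"
          using up[OF f] t by (intro add_mono mult_left_mono) auto
        finally show "f ?w \<le> (1 - t) * (?s x - c * hyp x) + t * (?s y - c * hyp y) + c * hyp ?w"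
          by simp
      qed
      then show "?s ?w - c * hyp ?w \<le> (1 - t) * (?s x - c * hyp x) + t * (?s y - c * hyp y)"
        by simp
    qed simp
    fix x z
    have "?s x \<le> (\<theta> - c) * \<bar>x - z\<bar> + (?s z - c * hyp z) + c * hyp x"
    proof (rule cSUP_least[OF M(1)])
      fix f assume f: "f \<in> M"
      have "(f x - c * hyp x) - (f z - c * hyp z) \<le> (\<theta> - c) * \<bar>x - z\<bar>"
        using M(2)[OF f] by (simp add: adm_def)
      with up[OF f, of z] show "f x \<le> (\<theta> - c) * \<bar>x - z\<bar> + (?s z - c * hyp z) + c * hyp x"
        by linarith
    qed
    then show "(?s x - c * hyp x) - (?s z - c * hyp z) \<le> (\<theta> - c) * \<bar>x - z\<bar>"
      by linarith
  qed
qed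

lemma adm_max:
  assumes "adm \<theta> c g" "adm \<theta> c h"
  shows "adm \<theta> c (\<lambda>x. max (g x) (h x))"
proof -
  have "adm \<theta> c (\<lambda>x. SUP f\<in>{g, h}. f x)"
    using assms by (intro adm_Sup) auto
  moreover have "(SUP f\<in>{g, h}. f x) = max (g x) (h x)" for x
    by (simp add: cSup_eq_Max)
  ultimately show ?thesis by simp
qed

text \<open>The inner clause bounds the diameter, within the window, of the set where
  \<open>g\<close> and \<open>h\<close> differ. The height bound is one-sided since the notion is
  applied to pairs with \<open>g \<le> h\<close>.\<close>

definition close_on :: "real \<Rightarrow> real \<Rightarrow> (real \<Rightarrow> real) \<Rightarrow> (real \<Rightarrow> real) \<Rightarrow> bool" where
  "close_on R \<eta> g h \<longleftrightarrow> (\<forall>x\<in>{-R..R}. h x - g x \<le> \<eta> \<and>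
     (\<forall>z\<in>{-R..R}. g x \<noteq> h x \<longrightarrow> g z \<noteq> h z \<longrightarrow> \<bar>x - z\<bar> \<le> \<eta>))"

text \<open>
  At a maximum point \<open>a\<close> of \<open>g' - g\<close> the excess convexity \<open>(c - d) * hyp\<close> of \<open>g'\<close> is replaced by its
  tangent at \<open>a\<close>, and the result is lowered until it exceeds \<open>g\<close> only near \<open>a\<close>.
\<close>

lemma adm_bump:
  assumes g': "adm \<theta> c g'" and g: "adm \<theta> d g" and cd: "0 < d" "d < c"
    and le: "g \<le> g'" and ne: "g \<noteq> g'" and \<eta>: "0 < \<eta>"
  shows "\<exists>h. adm \<theta> d h \<and> g \<le> h \<and> h \<le> g' \<and> h \<noteq> g \<and> close_on R \<eta> g h"
proof (cases "\<forall>x\<in>{-R..R}. g x = g' x")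
  \<comment> \<open>Nothing differs inside the window, so one can jump to \<open>g'\<close> at
    once.\<close>
  case True
  then have "close_on R \<eta> g g'" using \<eta> by (auto simp: close_on_def)
  with adm_antimono[OF g', of d] cd le ne show ?thesis by (intro exI[of _ g']) auto
next
  case False
  have "continuous_on {-R..R} (\<lambda>x. g' x - g x)"
    using adm_continuous[OF g'] adm_continuous[OF g] cd by (intro continuous_on_diff) auto
  then obtain a where a: "a \<in> {-R..R}"
    and amax: "\<And>x. x \<in> {-R..R} \<Longrightarrow> g' x - g x \<le> g' a - g a"
    using continuous_attains_sup[of "{-R..R}" "\<lambda>x. g' x - g x"] False by auto
  define M where "M = g' a - g a"
  have "M > 0"
  proof -
    from False obtain x where x: "x \<in> {-R..R}" "g x \<noteq> g' x" by auto
    with le have "g x < g' x" by (simp add: le_fun_def order_less_le)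
    with amax[OF x(1)] show ?thesis by (simp add: M_def)
  qed
  \<comment> \<open>A lower bound for what the tangent replacement costs at points of the window at
    distance at least \<open>\<eta> / 2\<close> from \<open>a\<close>.\<close>
  define \<gamma> where "\<gamma> = (c - d) * ((\<eta> / 2)\<^sup>2 / (2 * (1 + R\<^sup>2)\<^sup>2))"
  have R2: "0 < 2 * (1 + R\<^sup>2)\<^sup>2"
    using add_pos_nonneg[of 1 "R\<^sup>2"] by simp
  have "\<gamma> > 0"
    unfolding \<gamma>_def using \<eta> cd R2 by (intro mult_pos_pos divide_pos_pos) auto
  \<comment> \<open>The height of the bump above \<open>g\<close> at \<open>a\<close>: at most
    \<open>M\<close> to stay below \<open>g'\<close>, at most \<open>\<eta>\<close> for vertical and
    at most \<open>\<gamma>\<close> for horizontal closeness.\<close>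
  define \<delta> where "\<delta> = min M (min \<eta> \<gamma>)"
  have \<delta>: "0 < \<delta>" "\<delta> \<le> M" "\<delta> \<le> \<eta>" "\<delta> \<le> \<gamma>"
    using \<open>M > 0\<close> \<open>\<gamma> > 0\<close> \<eta> by (auto simp: \<delta>_def)
  define D where "D x = hyp x - (1 + a * x) / hyp a" for x
  have D0: "D x \<ge> 0" for x using hyp_tangent_ge by (simp add: D_def)
  have Da: "D a = 0" by (simp add: D_def hyp_tangent_eq)
  define \<psi> where "\<psi> x = g' x - (c - d) * D x - (M - \<delta>)" for x
  \<comment> \<open>Relative to the reserve \<open>d\<close>, the remainder of \<open>\<psi>\<close>
    is that of \<open>g'\<close> plus an affine function whose slope has modulus at most
    \<open>c - d\<close>; hence \<open>\<psi>\<close> is admissible.\<close>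
  have \<psi>_split: "\<psi> x - d * hyp x = (g' x - c * hyp x) + ((c - d) * (a / hyp a) * x + ((c - d) / hyp a - (M - \<delta>)))" for x
    by (simp add: \<psi>_def D_def algebra_simps add_divide_distrib diff_divide_distrib)
  have "adm \<theta> d \<psi>"
    unfolding adm_def
  proof (intro conjI allI)
    have "convex_on UNIV (\<lambda>x. (c - d) * (a / hyp a) * x + ((c - d) / hyp a - (M - \<delta>)))"
      by (rule convex_on_affine)
    from _ this have "convex_on UNIV (\<lambda>x. (g' x - c * hyp x) + ((c - d) * (a / hyp a) * x + ((c - d) / hyp a - (M - \<delta>))))"
      by (rule convex_on_add) (use g' in \<open>simp add: adm_def\<close>)
    then show "convex_on UNIV (\<lambda>x. \<psi> x - d * hyp x)"
      by (simp only: \<psi>_split)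
    fix x z
    have "(g' x - c * hyp x) - (g' z - c * hyp z) \<le> (\<theta> - c) * \<bar>x - z\<bar>"
      using g' by (simp add: adm_def)
    moreover have "(c - d) * (a / hyp a) * x - (c - d) * (a / hyp a) * z \<le> (c - d) * \<bar>x - z\<bar>"
    proof -
      have "(a / hyp a) * (x - z) \<le> \<bar>a / hyp a\<bar> * \<bar>x - z\<bar>"
        by (metis abs_ge_self abs_mult)
      also have "\<dots> \<le> \<bar>x - z\<bar>"
        using hyp_slope[of a] by (intro mult_left_le_one_le) auto
      finally have "(c - d) * ((a / hyp a) * (x - z)) \<le> (c - d) * \<bar>x - z\<bar>"
        using cd by (intro mult_left_mono) auto
      then show ?thesis by (simp only: right_diff_distrib mult.assoc)
    qed
    moreover have "(\<theta> - d) * \<bar>x - z\<bar> = (\<theta> - c) * \<bar>x - z\<bar> + (c - d) * \<bar>x - z\<bar>"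
      by (simp add: algebra_simps)
    ultimately show "(\<psi> x - d * hyp x) - (\<psi> z - d * hyp z) \<le> (\<theta> - d) * \<bar>x - z\<bar>"
      unfolding \<psi>_split by linarith
  qed
  then have adm_h: "adm \<theta> d (\<lambda>x. max (g x) (\<psi> x))"
    using g by (rule adm_max[rotated])
  have "\<psi> x \<le> g' x" for x
  proof -
    have "0 \<le> (c - d) * D x" using D0 cd by simp
    then show ?thesis using \<delta> by (simp add: \<psi>_def)
  qed
  then have h_le: "(\<lambda>x. max (g x) (\<psi> x)) \<le> g'" using le by (simp add: le_fun_def)
  have "\<psi> a = g a + \<delta>" by (simp add: \<psi>_def Da M_def)
  then have h_ne: "(\<lambda>x. max (g x) (\<psi> x)) \<noteq> g" using \<delta>(1) by (auto simp: fun_eq_iff intro!: exI[of _ a])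
  have near: "\<bar>x - a\<bar> < \<eta> / 2" if x: "x \<in> {-R..R}" and "g x \<noteq> max (g x) (\<psi> x)" for x
  proof -
    have "g x < \<psi> x" using that by (auto simp: max_def split: if_splits)
    \<comment> \<open>As \<open>g' - g\<close> is at most \<open>M\<close> on the window, rising
      above \<open>g\<close> forces the loss \<open>(c - d) * D x\<close> to be smaller than
      \<open>\<delta>\<close>.\<close>
    with amax[OF x] have "(c - d) * D x < \<delta>" by (simp add: \<psi>_def M_def)
    also have "\<delta> \<le> \<gamma>" by (rule \<delta>)
    finally have "D x < (\<eta> / 2)\<^sup>2 / (2 * (1 + R\<^sup>2)\<^sup>2)"
      unfolding \<gamma>_def by (rule mult_left_less_imp_less) (use cd in simp)
    moreover have "(x - a)\<^sup>2 / (2 * (1 + R\<^sup>2)\<^sup>2) \<le> D x"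
      unfolding D_def using x a by (intro hyp_tangent_gap) auto
    ultimately have "(x - a)\<^sup>2 / (2 * (1 + R\<^sup>2)\<^sup>2) < (\<eta> / 2)\<^sup>2 / (2 * (1 + R\<^sup>2)\<^sup>2)"
      by linarith
    then have "(x - a)\<^sup>2 < (\<eta> / 2)\<^sup>2"
      using R2 by (meson divide_right_mono less_imp_le not_less)
    then have "\<bar>x - a\<bar>\<^sup>2 < (\<eta> / 2)\<^sup>2" by simp
    then show ?thesis by (rule power2_less_imp_less) (use \<eta> in simp)
  qed
  have "close_on R \<eta> g (\<lambda>x. max (g x) (\<psi> x))"
    unfolding close_on_def
  proof (intro ballI conjI impI)
    fix x assume x: "x \<in> {-R..R}"
    have "0 \<le> (c - d) * D x" using D0 cd by simp
    with amax[OF x] \<delta>(3) \<eta> show "max (g x) (\<psi> x) - g x \<le> \<eta>"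
      by (auto simp: \<psi>_def M_def max_def)
    fix z assume z: "z \<in> {-R..R}" and "g x \<noteq> max (g x) (\<psi> x)" "g z \<noteq> max (g z) (\<psi> z)"
    then show "\<bar>x - z\<bar> \<le> \<eta>" using near[of x] near[of z] x by linarith
  qed
  with adm_h h_le h_ne show ?thesis
    by (intro exI[of _ "\<lambda>x. max (g x) (\<psi> x)"]) (auto simp: le_fun_def)
qed

section \<open>Subdividing layers\<close>

text \<open>A pair stands for the strip between two graphs. Distinct strips are stacked and share at
  most boundary points.\<close>

definition layers :: "real \<Rightarrow> real \<Rightarrow> ((real \<Rightarrow> real) \<times> (real \<Rightarrow> real)) set \<Rightarrow> bool" where
  "layers \<theta> c P \<longleftrightarrow>
     (\<forall>g g'. (g, g') \<in> P \<longrightarrow> adm \<theta> c g \<and> adm \<theta> c g' \<and> g \<le> g' \<and> g \<noteq> g') \<and>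
     (\<forall>k k' l l'. (k, k') \<in> P \<longrightarrow> (l, l') \<in> P \<longrightarrow> (k = l \<and> k' = l') \<or> k' \<le> l \<or> l' \<le> k)"

lemma layersD:
  assumes "layers \<theta> c P" "(g, g') \<in> P"
  shows "adm \<theta> c g" "adm \<theta> c g'" "g \<le> g'" "g \<noteq> g'"
  using assms unfolding layers_def by blast+

lemma layers_laminar:
  assumes "layers \<theta> c P" "(k, k') \<in> P" "(l, l') \<in> P"
  shows "(k = l \<and> k' = l') \<or> k' \<le> l \<or> l' \<le> k"
  using assms unfolding layers_def by blast

text \<open>
  In the second clause, \<open>B\<close> stands for the functions that a given sequence is eventually below. In the
  first alternative the sequence is trapped in a layer of \<open>Q\<close>; in the second one it is below \<open>s\<close> and
  above all of \<open>M\<close>, that is, on the graph of \<open>s\<close>.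
\<close>

definition subdivides :: "real \<Rightarrow> real \<Rightarrow> ((real \<Rightarrow> real) \<times> (real \<Rightarrow> real)) set \<Rightarrow>
    ((real \<Rightarrow> real) \<times> (real \<Rightarrow> real)) set \<Rightarrow> bool" where
  "subdivides R \<eta> P Q \<longleftrightarrow>
     (\<forall>k k'. (k, k') \<in> Q \<longrightarrow> close_on R \<eta> k k' \<and> (\<exists>a a'. (a, a') \<in> P \<and> a \<le> k \<and> k' \<le> a')) \<and>
     (\<forall>a a' B. (a, a') \<in> P \<longrightarrow> B a' \<longrightarrow> \<not> B a \<longrightarrow>
       (\<exists>k k'. (k, k') \<in> Q \<and> \<not> B k \<and> B k') \<or>
       (\<exists>s M. s \<in> insert a' (fst ` Q) \<and> B s \<and> M \<noteq> {} \<and> M \<subseteq> {k \<in> fst ` Q. \<not> B k} \<and>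
              (\<forall>x. s x = (SUP k\<in>M. k x))))"

lemma subdividesD:
  assumes "subdivides R \<eta> P Q" "(k, k') \<in> Q"
  shows "close_on R \<eta> k k'" "\<exists>a a'. (a, a') \<in> P \<and> a \<le> k \<and> k' \<le> a'"
  using assms unfolding subdivides_def by blast+

lemma subdivides_exit:
  assumes "subdivides R \<eta> P Q" "(a, a') \<in> P" "B a'" "\<not> B a"
  shows "(\<exists>k k'. (k, k') \<in> Q \<and> \<not> B k \<and> B k') \<or>
    (\<exists>s M. s \<in> insert a' (fst ` Q) \<and> B s \<and> M \<noteq> {} \<and> M \<subseteq> {k \<in> fst ` Q. \<not> B k} \<and>
           (\<forall>x. s x = (SUP k\<in>M. k x)))"
  using assms unfolding subdivides_def by simp

section \<open>Filling one layer by transfinite iteration\<close>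

text \<open>Bumps are iterated transfinitely from \<open>a\<close>, with suprema at limits, and each
  stage forms a layer with its successor. Only \<open>a'\<close> needs the larger reserve
  \<open>c\<close>: every bump spends \<open>c - d\<close> of it anew, while all stages keep the
  reserve \<open>d\<close>.\<close>

lemma bump_tower:
  assumes a': "adm \<theta> c a'" and a: "adm \<theta> d a" and cd: "0 < d" "d < c"
    and le: "a \<le> a'" and ne: "a \<noteq> a'" and \<eta>: "0 < \<eta>"
  shows "\<exists>Q. layers \<theta> d Q \<and> subdivides R \<eta> {(a, a')} Q"
proof -
  define X where "X = {g. adm \<theta> d g \<and> a \<le> g \<and> g \<le> a'}"
  define r where "r = {(g, h). g \<in> X \<and> h \<in> X \<and> g \<le> h}"
  define lub :: "(real \<Rightarrow> real) set \<Rightarrow> real \<Rightarrow> real" where "lub M = (\<lambda>x. SUP k\<in>M. k x)" for M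
  \<comment> \<open>No bump is possible at \<open>a'\<close>, so \<open>T\<close> fixes it; this
    makes \<open>T\<close> increasing on all of \<open>X\<close>, as the fixpoint theory
    requires.\<close>
  define T where "T g = (if g = a' then a' else
      SOME h. adm \<theta> d h \<and> g \<le> h \<and> h \<le> a' \<and> h \<noteq> g \<and> close_on R \<eta> g h)" for g
  have T: "adm \<theta> d (T g) \<and> g \<le> T g \<and> T g \<le> a' \<and> T g \<noteq> g \<and> close_on R \<eta> g (T g)"
    if "g \<in> X" "g \<noteq> a'" for g
  proof -
    have "\<exists>h. adm \<theta> d h \<and> g \<le> h \<and> h \<le> a' \<and> h \<noteq> g \<and> close_on R \<eta> g h"
      using that by (intro adm_bump[OF a' _ cd _ _ \<eta>]) (auto simp: X_def)
    from someI_ex[OF this] show ?thesis using that(2) by (simp add: T_def)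
  qed
  have aX: "a \<in> X" using a le by (simp add: X_def)
  have a'X: "a' \<in> X" using adm_antimono[OF a'] cd le by (simp add: X_def)
  have Field: "Field r = X" by (auto simp: r_def Field_def)
  have ChX: "M \<subseteq> X" if "M \<in> Chains r" for M
    using Chains_FieldD[OF that] Field by auto
  have bdd: "bdd_above ((\<lambda>k. k x) ` M)" if "M \<subseteq> X" for M x
    using that by (intro bdd_aboveI[of _ "a' x"]) (auto simp: X_def le_fun_def)
  have upper: "k \<le> lub M" if "M \<subseteq> X" "k \<in> M" for M k
    using bdd[OF that(1)] that(2) by (auto simp: le_fun_def lub_def intro: cSUP_upper)
  have least: "lub M \<le> z" if "M \<noteq> {}" "\<And>k. k \<in> M \<Longrightarrow> k \<le> z" for M z
    using that by (auto simp: le_fun_def lub_def intro!: cSUP_least)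
  have lubX: "lub M \<in> X" if "M \<subseteq> X" "M \<noteq> {}" for M
  proof -
    have "adm \<theta> d (lub M)"
      unfolding lub_def using that bdd[OF that(1)] by (intro adm_Sup) (auto simp: X_def)
    moreover have "a \<le> lub M"
    proof -
      obtain k where "k \<in> M" using \<open>M \<noteq> {}\<close> by blast
      then have "a \<le> k" using that by (auto simp: X_def)
      also have "k \<le> lub M" using upper that \<open>k \<in> M\<close> by blast
      finally show ?thesis .
    qed
    moreover have "lub M \<le> a'"
      using that by (intro least) (auto simp: X_def)
    ultimately show ?thesis by (simp add: X_def)
  qed
  interpret bourbaki_witt_fixpoint lub r T
  proof
    show "Partial_order r"
      unfolding order_on_defs Field
      by (auto simp: r_def refl_on_def trans_def antisym_def)
    show "(lub M, z) \<in> r" if "M \<in> Chains r" "M \<noteq> {}" "\<And>x. x \<in> M \<Longrightarrow> (x, z) \<in> r" for M z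
      using that(2,3) lubX[OF ChX[OF that(1)] that(2)] least[OF that(2), of z] by (auto simp: r_def)
    show "(x, lub M) \<in> r" if "M \<in> Chains r" "x \<in> M" for M x
      using that(2) lubX[OF ChX[OF that(1)]] upper[OF ChX[OF that(1)] that(2)] ChX[OF that(1)]
      by (auto simp: r_def)
    show "lub M \<in> Field r" if "M \<in> Chains r" "M \<noteq> {}" for M
      using lubX[OF ChX[OF that(1)] that(2)] Field by simp
    show "(x, T x) \<in> r" if "x \<in> Field r" for x
    proof (cases "x = a'")
      case True then show ?thesis using a'X by (simp add: T_def r_def)
    next
      case False
      have "x \<in> X" using that Field by simp
      with T[OF this False] show ?thesis by (auto simp: r_def X_def)
    qed
  qed
  let ?I = "iterates_above a"
  have aF: "a \<in> Field r" using aX Field by simp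
  have IX: "k \<in> X" if "k \<in> ?I" for k
    using iterates_above_Field[OF that aF] Field by simp
  define P where "P = {(k, T k) | k. k \<in> ?I \<and> k \<noteq> a'}"
  have fstP: "fst ` P = ?I - {a'}" by (force simp: P_def)
  have elem: "adm \<theta> d k \<and> adm \<theta> d k' \<and> a \<le> k \<and> k \<le> k' \<and> k' \<le> a' \<and> k \<noteq> k' \<and> close_on R \<eta> k k'"
    if "(k, k') \<in> P" for k k'
  proof -
    have "k \<in> X" "k \<noteq> a'" "k' = T k" using that IX by (auto simp: P_def)
    with T[of k] show ?thesis by (auto simp: X_def)
  qed
  have laminar: "(k = l \<and> k' = l') \<or> k' \<le> l \<or> l' \<le> k" if "(k, k') \<in> P" "(l, l') \<in> P" for k k' l l'
  proof -
    have k: "k \<in> ?I" "k' = T k" and l: "l \<in> ?I" "l' = T l" using that by (auto simp: P_def)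
    \<comment> \<open>No stage lies strictly between \<open>u\<close> and \<open>T u\<close>; since
      any two stages are reached one from the other, the layers are stacked.\<close>
    have succ: "u = v \<or> T u \<le> v" if u: "u \<in> ?I" and v: "v \<in> iterates_above u" for u v
    proof -
      have uF: "u \<in> Field r" using IX[OF u] Field by simp
      have TuF: "T u \<in> Field r" using increasing[OF uF] by (rule FieldI2)
      from iterates_above_successor[OF v uF] show ?thesis
        using iterates_above_ge[OF _ TuF, of v] by (auto simp: r_def)
    qed
    from iterates_above_triangle[OF k(1) l(1) aF] show ?thesis
      using succ[OF k(1)] succ[OF l(1)] k(2) l(2) by auto
  qed
  have exit: "(\<exists>k k'. (k, k') \<in> P \<and> \<not> B k \<and> B k') \<or>
      (\<exists>s M. s \<in> insert a' (fst ` P) \<and> B s \<and> M \<noteq> {} \<and> M \<subseteq> {k \<in> fst ` P. \<not> B k} \<and>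
             (\<forall>x. s x = (SUP k\<in>M. k x)))" if B: "B a'" "\<not> B a" for B
  proof -
    \<comment> \<open>The supremum \<open>s\<close> of the stages where \<open>B\<close> fails is
      again a stage. If \<open>B s\<close>, then \<open>s\<close> and \<open>M\<close> give the
      second alternative; otherwise \<open>s\<close> is the last failing stage and
      \<open>(s, T s)\<close> gives the first.\<close>
    define M where "M = {k \<in> ?I. \<not> B k}"
    define s where "s = lub M"
    have "a \<in> M" using B base by (auto simp: M_def)
    then have "M \<noteq> {}" by auto
    have Mc: "M \<in> Chains r"
      using chain_iterates_above[OF aF] by (rule in_Chains_subset) (auto simp: M_def)
    have sI: "s \<in> ?I"
      unfolding s_def using Mc \<open>M \<noteq> {}\<close> by (rule Sup) (auto simp: M_def)
    have MP: "M \<subseteq> {k \<in> fst ` P. \<not> B k}" using B by (auto simp: fstP M_def)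
    show ?thesis
    proof (cases "B s")
      case True
      then show ?thesis using sI MP \<open>M \<noteq> {}\<close>
        by (intro disjI2 exI[of _ s] exI[of _ M]) (auto simp: fstP s_def lub_def)
    next
      case False
      then have "s \<noteq> a'" using B by auto
      have "B (T s)"
      proof (rule ccontr)
        assume "\<not> B (T s)"
        then have "T s \<in> M" using step[OF sI] by (simp add: M_def)
        then have "T s \<le> s" unfolding s_def using ChX[OF Mc] by (intro upper)
        with T[OF IX[OF sI] \<open>s \<noteq> a'\<close>] show False by (metis order_antisym)
      qed
      then show ?thesis using False sI \<open>s \<noteq> a'\<close> by (auto simp: P_def)
    qed
  qed
  have "layers \<theta> d P"
    unfolding layers_def using elem laminar by (blast intro: order_refl)
  moreover have "subdivides R \<eta> {(a, a')} P"
    unfolding subdivides_def using elem exit by simp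
  ultimately show ?thesis by blast
qed

section \<open>Refining all layers, scale by scale\<close>

lemma layers_refine:
  assumes P: "layers \<theta> c P" and cd: "0 < d" "d < c" and \<eta>: "0 < \<eta>"
  shows "\<exists>Q. layers \<theta> d Q \<and> subdivides R \<eta> P Q"
proof -
  have "\<exists>Q. layers \<theta> d Q \<and> subdivides R \<eta> {p} Q" if "p \<in> P" for p
  proof -
    obtain a a' where p: "p = (a, a')" by (cases p)
    have A: "adm \<theta> c a'" "adm \<theta> c a" "a \<le> a'" "a \<noteq> a'"
      using layersD[OF P that[unfolded p]] by simp_all
    have "adm \<theta> d a" using adm_antimono[OF A(2)] cd by simp
    then show ?thesis unfolding p by (intro bump_tower[OF A(1) _ cd A(3,4) \<eta>])
  qed
  then obtain N where N: "\<And>p. p \<in> P \<Longrightarrow> layers \<theta> d (N p)" "\<And>p. p \<in> P \<Longrightarrow> subdivides R \<eta> {p} (N p)"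
    by metis
  define Q where "Q = (\<Union>p\<in>P. N p)"
  have elem: "adm \<theta> d k \<and> adm \<theta> d k' \<and> k \<le> k' \<and> k \<noteq> k'"
    "close_on R \<eta> k k' \<and> fst p \<le> k \<and> k' \<le> snd p"
    if "p \<in> P" "(k, k') \<in> N p" for p k k'
  proof -
    show "adm \<theta> d k \<and> adm \<theta> d k' \<and> k \<le> k' \<and> k \<noteq> k'"
      using layersD[OF N(1)[OF that(1)] that(2)] by blast
    show "close_on R \<eta> k k' \<and> fst p \<le> k \<and> k' \<le> snd p"
      using subdividesD[OF N(2)[OF that(1)] that(2)] by auto
  qed
  have between: "fst p \<le> k" "k \<le> snd p" "fst p \<le> k'" "k' \<le> snd p"
    if "p \<in> P" "(k, k') \<in> N p" for p k k'
    using elem[OF that] by (meson order_trans)+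
  have laminarP: "p = q \<or> snd p \<le> fst q \<or> snd q \<le> fst p" if "p \<in> P" "q \<in> P" for p q
  proof -
    obtain a a' b b' where "p = (a, a')" "q = (b, b')" by (cases p, cases q)
    then show ?thesis using layers_laminar[OF P, of a a' b b'] that by auto
  qed
  have laminar: "(k = l \<and> k' = l') \<or> k' \<le> l \<or> l' \<le> k"
    if "p \<in> P" "(k, k') \<in> N p" "q \<in> P" "(l, l') \<in> N q" for p q k k' l l'
    using laminarP[OF that(1,3)]
  proof (elim disjE)
    assume "p = q"
    then show ?thesis using layers_laminar[OF N(1)[OF that(1)] that(2)] that(4) by blast
  next
    assume "snd p \<le> fst q"
    with between(4)[OF that(1,2)] between(1)[OF that(3,4)] show ?thesis by (meson order_trans)
  next
    assume "snd q \<le> fst p"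
    with between(4)[OF that(3,4)] between(1)[OF that(1,2)] show ?thesis by (meson order_trans)
  qed
  have "adm \<theta> d k \<and> adm \<theta> d k' \<and> k \<le> k' \<and> k \<noteq> k'" if "(k, k') \<in> Q" for k k'
    using that elem(1) by (auto simp: Q_def)
  moreover have "(k = l \<and> k' = l') \<or> k' \<le> l \<or> l' \<le> k"
    if kl: "(k, k') \<in> Q" "(l, l') \<in> Q" for k k' l l'
  proof -
    obtain p q where "p \<in> P" "(k, k') \<in> N p" "q \<in> P" "(l, l') \<in> N q"
      using kl unfolding Q_def by blast
    then show ?thesis by (rule laminar)
  qed
  ultimately have "layers \<theta> d Q"
    unfolding layers_def by blast
  moreover have "subdivides R \<eta> P Q"
  proof -
    have "\<exists>a a'. (a, a') \<in> P \<and> a \<le> k \<and> k' \<le> a'" "close_on R \<eta> k k'" if k: "(k, k') \<in> Q" for k k'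
    proof -
      obtain a a' where *: "(a, a') \<in> P" "(k, k') \<in> N (a, a')"
        using k by (auto simp: Q_def)
      from elem(2)[OF *] show "close_on R \<eta> k k'" by blast
      from elem(2)[OF *] *(1) show "\<exists>a a'. (a, a') \<in> P \<and> a \<le> k \<and> k' \<le> a'"
        by auto
    qed
    moreover have "(\<exists>k k'. (k, k') \<in> Q \<and> \<not> B k \<and> B k') \<or>
       (\<exists>s M. s \<in> insert a' (fst ` Q) \<and> B s \<and> M \<noteq> {} \<and> M \<subseteq> {k \<in> fst ` Q. \<not> B k} \<and>
              (\<forall>x. s x = (SUP k\<in>M. k x)))"
      if p: "(a, a') \<in> P" and B: "B a'" "\<not> B a" for a a' B
    proof -
      have sub: "N (a, a') \<subseteq> Q" using p by (auto simp: Q_def)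
      have "(\<exists>k k'. (k, k') \<in> N (a, a') \<and> \<not> B k \<and> B k') \<or>
         (\<exists>s M. s \<in> insert a' (fst ` N (a, a')) \<and> B s \<and> M \<noteq> {} \<and> M \<subseteq> {k \<in> fst ` N (a, a'). \<not> B k} \<and>
                (\<forall>x. s x = (SUP k\<in>M. k x)))"
        by (rule subdivides_exit[OF N(2)[OF p] _ B]) simp
      then show ?thesis
      proof (rule disj_forward)
        show "\<exists>k k'. (k, k') \<in> Q \<and> \<not> B k \<and> B k'" if "\<exists>k k'. (k, k') \<in> N (a, a') \<and> \<not> B k \<and> B k'"
          using that sub by blast
      next
        assume "\<exists>s M. s \<in> insert a' (fst ` N (a, a')) \<and> B s \<and> M \<noteq> {} \<and>
          M \<subseteq> {k \<in> fst ` N (a, a'). \<not> B k} \<and> (\<forall>x. s x = (SUP k\<in>M. k x))"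
        then obtain s M where sM: "s \<in> insert a' (fst ` N (a, a'))" "B s" "M \<noteq> {}"
          "M \<subseteq> {k \<in> fst ` N (a, a'). \<not> B k}" "\<forall>x. s x = (SUP k\<in>M. k x)"
          by (elim exE conjE)
        have "s \<in> insert a' (fst ` Q)" using sM(1) sub by blast
        moreover have "M \<subseteq> {k \<in> fst ` Q. \<not> B k}" using sM(4) sub by blast
        ultimately show "\<exists>s M. s \<in> insert a' (fst ` Q) \<and> B s \<and> M \<noteq> {} \<and>
          M \<subseteq> {k \<in> fst ` Q. \<not> B k} \<and> (\<forall>x. s x = (SUP k\<in>M. k x))"
          using sM(2,3,5) by (intro exI conjI)
      qed
    qed
    ultimately show ?thesis unfolding subdivides_def by simp
  qed
  ultimately show ?thesis by blast
qed

text \<open>The reserves \<open>\<theta> / real (Suc n)\<close> decrease strictly, so each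
  refinement has something to spend, yet stay positive, so every function remains strictly convex.
  Meanwhile the windows exhaust the line and the tolerances tend to 0.\<close>

lemma layers_hierarchy:
  assumes \<theta>: "0 < \<theta>"
  shows "\<exists>P. P 0 = range (\<lambda>i::int. (\<lambda>x. \<theta> * hyp x + of_int i, \<lambda>x. \<theta> * hyp x + of_int i + 1)) \<and>
    (\<forall>n. layers \<theta> (\<theta> / real (Suc n)) (P n)) \<and>
    (\<forall>n. subdivides (real n) (1 / real (Suc n)) (P n) (P (Suc n)))"
proof -
  let ?P0 = "range (\<lambda>i::int. (\<lambda>x. \<theta> * hyp x + of_int i, \<lambda>x. \<theta> * hyp x + of_int i + 1))"
  \<comment> \<open>The clause for \<open>n = 0\<close> pins the first family, which dependent
    choice alone would leave open.\<close>
  have "\<exists>P. \<forall>n. (layers \<theta> (\<theta> / real (Suc n)) (P n) \<and> (n = 0 \<longrightarrow> P n = ?P0)) \<and>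
    subdivides (real n) (1 / real (Suc n)) (P n) (P (Suc n))"
  proof (rule dependent_nat_choice)
    have adm0: "adm \<theta> \<theta> (\<lambda>x. \<theta> * hyp x + v)" for v
      using convex_on_affine[of 0 v] by (simp add: adm_def)
    have adm1: "adm \<theta> \<theta> (\<lambda>x. \<theta> * hyp x + of_int i + 1)" for i :: int
      using adm0[of "of_int i + 1"] by (simp add: add.assoc)
    have "adm \<theta> \<theta> g \<and> adm \<theta> \<theta> g' \<and> g \<le> g' \<and> g \<noteq> g'" if "(g, g') \<in> ?P0" for g g'
      using that adm0 adm1 by (auto simp: le_fun_def fun_eq_iff)
    moreover have "(k = l \<and> k' = l') \<or> k' \<le> l \<or> l' \<le> k"
      if "(k, k') \<in> ?P0" "(l, l') \<in> ?P0" for k k' l l'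
    proof -
      from that obtain i j :: int where
        "k = (\<lambda>x. \<theta> * hyp x + of_int i)" "k' = (\<lambda>x. \<theta> * hyp x + of_int i + 1)"
        "l = (\<lambda>x. \<theta> * hyp x + of_int j)" "l' = (\<lambda>x. \<theta> * hyp x + of_int j + 1)"
        by auto
      moreover have "i = j \<or> real_of_int i + 1 \<le> of_int j \<or> real_of_int j + 1 \<le> of_int i"
        by linarith
      ultimately show ?thesis by (auto simp: le_fun_def)
    qed
    ultimately have "layers \<theta> \<theta> ?P0"
      unfolding layers_def by blast
    then show "\<exists>P. layers \<theta> (\<theta> / real (Suc 0)) P \<and> (0 = (0::nat) \<longrightarrow> P = ?P0)"
      by simp
    fix P n assume "layers \<theta> (\<theta> / real (Suc n)) P \<and> (n = 0 \<longrightarrow> P = ?P0)"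
    moreover have "0 < \<theta> / real (Suc (Suc n))" "\<theta> / real (Suc (Suc n)) < \<theta> / real (Suc n)"
      using \<theta> by (auto simp: field_simps)
    ultimately have "\<exists>Q. layers \<theta> (\<theta> / real (Suc (Suc n))) Q \<and> subdivides (real n) (1 / real (Suc n)) P Q"
      by (intro layers_refine[of \<theta> "\<theta> / real (Suc n)"]) auto
    then show "\<exists>Q. (layers \<theta> (\<theta> / real (Suc (Suc n))) Q \<and> (Suc n = 0 \<longrightarrow> Q = ?P0)) \<and>
        subdivides (real n) (1 / real (Suc n)) P Q"
      by simp
  qed
  then obtain P where P: "\<forall>n. (layers \<theta> (\<theta> / real (Suc n)) (P n) \<and> (n = 0 \<longrightarrow> P n = ?P0)) \<and>
    subdivides (real n) (1 / real (Suc n)) (P n) (P (Suc n))" ..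
  show ?thesis
    by (rule exI[of _ P]) (simp only: P simp_thms)
qed

lemma layers_chain:
  assumes layers: "\<And>n. layers \<theta> (c n) (P n)"
    and subdivides: "\<And>n. subdivides (R n) (\<eta> n) (P n) (P (Suc n))"
    and g: "g \<in> fst ` P m \<union> snd ` P m" and h: "h \<in> fst ` P n \<union> snd ` P n"
  shows "g \<le> h \<or> h \<le> g"
proof -
  \<comment> \<open>A finer layer lies inside a given coarser one, or entirely below or above it,
    because it inherits the position of the layer it came from.\<close>
  have nested: "(a \<le> b \<and> b' \<le> a') \<or> b' \<le> a \<or> a' \<le> b"
    if "n \<le> m" "(a, a') \<in> P n" "(b, b') \<in> P m" for m n a a' b b'
    using that(1,3)
  proof (induction m arbitrary: b b' rule: dec_induct)
    case base
    with layers_laminar[OF layers that(2)] show ?case by blast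
  next
    case (step m)
    obtain d d' where d: "(d, d') \<in> P m" "d \<le> b" "b' \<le> d'"
      using subdividesD(2)[OF subdivides step.prems] by blast
    from step.IH[OF d(1)] show ?case
      using order_trans[of a d b] order_trans[of b' d' a'] order_trans[of b' d' a]
        order_trans[of a' d b] d(2,3) by argo
  qed
  have ord: "a \<le> a'" if "(a, a') \<in> P n" for n a a'
    using layersD(3)[OF layers that] .
  have *: "g \<le> h \<or> h \<le> g"
    if nm: "n \<le> m" and g: "g \<in> fst ` P n \<union> snd ` P n" and h: "h \<in> fst ` P m \<union> snd ` P m" for m n g h
  proof -
    obtain a a' where a: "(a, a') \<in> P n" "g = a \<or> g = a'" using g by auto
    obtain b b' where b: "(b, b') \<in> P m" "h = b \<or> h = b'" using h by auto
    have "a \<le> b \<and> b \<le> a' \<and> a \<le> b' \<and> b' \<le> a' \<or>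
        b \<le> a \<and> b \<le> a' \<and> b' \<le> a \<and> b' \<le> a' \<or> a \<le> b \<and> a' \<le> b \<and> a \<le> b' \<and> a' \<le> b'"
      using nested[OF nm a(1) b(1)]
    proof (elim disjE conjE)
      assume "a \<le> b" "b' \<le> a'"
      then show ?thesis using order_trans[OF ord[OF b(1)]] order_trans[OF _ ord[OF b(1)]] by blast
    next
      assume "b' \<le> a"
      moreover from this have "b \<le> a" "b' \<le> a'"
        using order_trans[OF ord[OF b(1)]] order_trans[OF _ ord[OF a(1)]] by blast+
      moreover from this(1) have "b \<le> a'" using ord[OF a(1)] by (rule order_trans)
      ultimately show ?thesis by blast
    next
      assume "a' \<le> b"
      moreover from this have "a \<le> b" "a' \<le> b'"
        using order_trans[OF ord[OF a(1)]] order_trans[OF _ ord[OF b(1)]] by blast+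
      moreover from this(1) have "a \<le> b'" using ord[OF b(1)] by (rule order_trans)
      ultimately show ?thesis by blast
    qed
    with a(2) b(2) show ?thesis by auto
  qed
  show ?thesis
    using *[OF _ g h] *[OF _ h g] by (cases "m \<le> n") auto
qed

section \<open>The slope function\<close>

text \<open>Each slope from a graph on the left to \<open>(x, y)\<close> is at most each slope from
  \<open>(x, y)\<close> to a graph on the right, even for different members, so the supremum of the
  left slopes serves all members at once.\<close>

lemma chain_support_slope:
  fixes G :: "(real \<Rightarrow> real) set"
  assumes chain: "\<And>g h. g \<in> G \<Longrightarrow> h \<in> G \<Longrightarrow> g \<le> h \<or> h \<le> g"
    and conv: "\<And>g. g \<in> G \<Longrightarrow> convex_on UNIV g"
    and lip: "\<And>g x z. g \<in> G \<Longrightarrow> g x - g z \<le> \<theta> * \<bar>x - z\<bar>"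
    and ne: "\<exists>g\<in>G. y \<le> g x" and \<theta>: "\<theta> < \<epsilon>"
  shows "\<exists>t. -\<epsilon> < t \<and> t < \<epsilon> \<and> (\<forall>g\<in>G. y \<le> g x \<longrightarrow> (\<forall>z. y + t * (z - x) \<le> g z))"
proof -
  define G' where "G' = {g \<in> G. y \<le> g x}"
  define S where "S = {(y - g z) / (x - z) | g z. g \<in> G' \<and> z < x}"
  have S_le: "s \<le> \<theta>" if "s \<in> S" for s
  proof -
    obtain g z where g: "g \<in> G" "y \<le> g x" "z < x" and s: "s = (y - g z) / (x - z)"
      using \<open>s \<in> S\<close> by (auto simp: S_def G'_def)
    have "y - g z \<le> \<theta> * (x - z)" using lip[OF g(1), of x z] g by simp
    then show ?thesis using g(3) by (simp add: s pos_divide_le_eq)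
  qed
  have bdd: "bdd_above S" using S_le by (intro bdd_aboveI[of _ \<theta>])
  have S_cross: "s \<le> (h w - y) / (w - x)" if "s \<in> S" and h: "h \<in> G'" and w: "x < w" for s h w
  proof -
    obtain g z where g: "g \<in> G'" "z < x" and s: "s = (y - g z) / (x - z)"
      using \<open>s \<in> S\<close> by (auto simp: S_def)
    \<comment> \<open>The smaller of \<open>g\<close> and \<open>h\<close> lies below both and still
      passes on or above \<open>(x, y)\<close>, so convexity of this one function compares the
      slopes.\<close>
    obtain f where f: "f \<in> G'" "f z \<le> g z" "f w \<le> h w"
      using chain[of g h] g h by (auto simp: G'_def le_fun_def)
    have "(f x - f z) / (x - z) \<le> (f w - f x) / (w - x)"
    proof -
      have "convex_on UNIV f" using conv f by (auto simp: G'_def)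
      define l where "l = (x - z) / (w - z)"
      have l: "l * (w - z) = x - z" "0 \<le> l" "l \<le> 1"
        using g w by (auto simp: l_def)
      have "f ((1 - l) *\<^sub>R z + l *\<^sub>R w) \<le> (1 - l) * f z + l * f w"
        using convex_onD[OF \<open>convex_on UNIV f\<close>] l by simp
      moreover have "(1 - l) *\<^sub>R z + l *\<^sub>R w = x"
        using l(1) by (simp add: algebra_simps)
      ultimately have "f x \<le> (1 - l) * f z + l * f w" by simp
      then have "f x * (w - z) \<le> ((1 - l) * f z + l * f w) * (w - z)"
        using g w by (intro mult_right_mono) auto
      also have "\<dots> = ((w - z) - l * (w - z)) * f z + l * (w - z) * f w"
        by (simp add: algebra_simps)
      finally have "f x * (w - z) \<le> ((w - z) - (x - z)) * f z + (x - z) * f w"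
        by (simp only: l(1))
      then have "(f x - f z) * (w - x) \<le> (f w - f x) * (x - z)"
        by (simp add: algebra_simps)
      then show ?thesis
        using g w by (simp add: frac_le_eq divide_simps)
    qed
    moreover have "s \<le> (f x - f z) / (x - z)"
      unfolding s using g f by (intro divide_right_mono) (auto simp: G'_def)
    moreover have "(f w - f x) / (w - x) \<le> (h w - y) / (w - x)"
      using w f by (intro divide_right_mono) (auto simp: G'_def)
    ultimately show ?thesis by linarith
  qed
  obtain g where g: "g \<in> G'" using ne by (auto simp: G'_def)
  have "(y - g (x - 1)) / (x - (x - 1)) \<in> S"
    unfolding S_def using g by (intro CollectI exI[of _ g] exI[of _ "x - 1"]) auto
  then have "S \<noteq> {}" by auto
  define t where "t = Sup S"
  have "t \<le> \<theta>" unfolding t_def using \<open>S \<noteq> {}\<close> S_le by (rule cSup_least)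
  have lower: "(y - h z) / (x - z) \<le> t" if "h \<in> G'" "z < x" for h z
    unfolding t_def using that bdd by (intro cSup_upper) (auto simp: S_def)
  have upper: "t \<le> (h z - y) / (z - x)" if "h \<in> G'" "x < z" for h z
    unfolding t_def using \<open>S \<noteq> {}\<close> S_cross[OF _ that] by (rule cSup_least)
  have "-\<epsilon> < t"
  proof -
    \<comment> \<open>So far to the left that the Lipschitz bound puts the slope above
      \<open>-\<epsilon>\<close>, however high \<open>g x\<close> is above \<open>y\<close>.\<close>
    define u where "u = (g x - y + 1) / (\<epsilon> - \<theta>)"
    have "g x \<ge> y" "g \<in> G" using g by (auto simp: G'_def)
    then have u: "u > 0" using \<theta> by (simp add: u_def)
    have "u * (\<epsilon> - \<theta>) = g x - y + 1" using \<theta> by (simp add: u_def)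
    moreover have "g (x - u) \<le> g x + \<theta> * u" using lip[OF \<open>g \<in> G\<close>, of "x - u" x] u by simp
    ultimately have "-\<epsilon> * u < y - g (x - u)" by (simp add: algebra_simps)
    then have "-\<epsilon> < (y - g (x - u)) / (x - (x - u))" using u by (simp add: pos_less_divide_eq)
    also have "\<dots> \<le> t" using u by (intro lower g) auto
    finally show ?thesis .
  qed
  moreover have "y + t * (z - x) \<le> h z" if "h \<in> G" "y \<le> h x" for h z
  proof -
    have h: "h \<in> G'" using that by (simp add: G'_def)
    consider "z < x" | "z = x" | "x < z" by linarith
    then show ?thesis
    proof cases
      case 1
      with lower[OF h 1] show ?thesis by (simp add: pos_divide_le_eq algebra_simps)
    next
      case 3
      with upper[OF h 3] show ?thesis by (simp add: pos_le_divide_eq algebra_simps)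
    qed (use that in simp)
  qed
  ultimately show ?thesis using \<open>t \<le> \<theta>\<close> \<theta> by (intro exI[of _ t]) auto
qed

section \<open>Convergence of the sequences governed by the slope function\<close>

theorem corollary1p4:
  fixes \<epsilon> :: real
  assumes "0 < \<epsilon>" and "\<epsilon> < 1/2"
  shows "\<exists>\<tau> :: real \<times> real \<Rightarrow> real.
    range \<tau> \<subseteq> {-\<epsilon><..<\<epsilon>} \<and>
    (\<forall>x y :: nat \<Rightarrow> real.
      bdd_below (range (\<lambda>n. y n - \<epsilon> * \<bar>x n\<bar>)) \<longrightarrow>
      (\<forall>n. y (Suc n) - y n \<le> \<tau> (x n, y n) * (x (Suc n) - x n)) \<longrightarrow>
      convergent (\<lambda>n. (x n, y n)))"
proof -
  define \<theta> where "\<theta> = \<epsilon> / 2"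
  have \<theta>: "0 < \<theta>" "\<theta> < \<epsilon>" using assms by (auto simp: \<theta>_def)
  obtain P where P0: "P 0 = range (\<lambda>i::int. (\<lambda>x. \<theta> * hyp x + of_int i, \<lambda>x. \<theta> * hyp x + of_int i + 1))"
    and "\<forall>n. layers \<theta> (\<theta> / real (Suc n)) (P n)"
    and "\<forall>n. subdivides (real n) (1 / real (Suc n)) (P n) (P (Suc n))"
    using layers_hierarchy[OF \<theta>(1)] by (elim exE conjE)
  then have layers: "layers \<theta> (\<theta> / real (Suc n)) (P n)"
    and subdivides: "subdivides (real n) (1 / real (Suc n)) (P n) (P (Suc n))" for n
    by simp_all
  define G where "G = (\<Union>n. fst ` P n \<union> snd ` P n)"
  have PG: "g \<in> G" "g' \<in> G" if "(g, g') \<in> P n" for g g' n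
    using that by (force simp: G_def)+
  have admG: "\<exists>c>0. adm \<theta> c g" if "g \<in> G" for g
  proof -
    obtain n g' where "(g, g') \<in> P n \<or> (g', g) \<in> P n"
      using \<open>g \<in> G\<close> unfolding G_def by force
    then have "adm \<theta> (\<theta> / real (Suc n)) g"
      using layersD(1)[OF layers, of g g' n] layersD(2)[OF layers, of g' g n] by blast
    moreover have "0 < \<theta> / real (Suc n)" using \<theta> by simp
    ultimately show ?thesis by blast
  qed
  have chainG: "g \<le> h \<or> h \<le> g" if "g \<in> G" "h \<in> G" for g h
  proof -
    obtain m n where "g \<in> fst ` P m \<union> snd ` P m" "h \<in> fst ` P n \<union> snd ` P n"
      using \<open>g \<in> G\<close> \<open>h \<in> G\<close> unfolding G_def by blast
    then show ?thesis
      by (rule layers_chain[where P = P and \<theta> = \<theta> and c = "\<lambda>n. \<theta> / real (Suc n)"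
            and R = real and \<eta> = "\<lambda>n. 1 / real (Suc n)", OF layers subdivides])
  qed
  have lipG: "g x - g z \<le> \<theta> * \<bar>x - z\<bar>" if "g \<in> G" for g x z
  proof -
    obtain c where "0 < c" "adm \<theta> c g" using admG[OF \<open>g \<in> G\<close>] by blast
    then show ?thesis by (intro adm_lipschitz) auto
  qed
  have baseG: "(\<lambda>x. \<theta> * hyp x + of_int i) \<in> G" for i :: int
    by (rule PG(1)[of _ "\<lambda>x. \<theta> * hyp x + of_int i + 1" 0]) (simp add: P0)
  have "\<forall>p. \<exists>t. -\<epsilon> < t \<and> t < \<epsilon> \<and> (\<forall>g\<in>G. snd p \<le> g (fst p) \<longrightarrow> (\<forall>z. snd p + t * (z - fst p) \<le> g z))"
  proof (rule allI, rule chain_support_slope[OF chainG _ lipG _ \<theta>(2)])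
    fix p :: "real \<times> real"
    show "convex_on UNIV g" if "g \<in> G" for g
    proof -
      obtain c where "0 < c" "adm \<theta> c g" using admG[OF \<open>g \<in> G\<close>] by blast
      then show ?thesis by (intro adm_convex) auto
    qed
    show "\<exists>g\<in>G. snd p \<le> g (fst p)"
      by (rule bexI[OF _ baseG[of "\<lceil>snd p - \<theta> * hyp (fst p)\<rceil>"]]) linarith
  qed
  then obtain \<tau> where *: "\<forall>p. -\<epsilon> < \<tau> p \<and> \<tau> p < \<epsilon> \<and>
      (\<forall>g\<in>G. snd p \<le> g (fst p) \<longrightarrow> (\<forall>z. snd p + \<tau> p * (z - fst p) \<le> g z))"
    by (rule exE[OF choice])
  have \<tau>: "-\<epsilon> < \<tau> p" "\<tau> p < \<epsilon>" for p
    using * by blast+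
  have support: "v + \<tau> (u, v) * (z - u) \<le> g z" if "g \<in> G" "v \<le> g u" for u v z g
  proof -
    have "\<forall>g\<in>G. v \<le> g u \<longrightarrow> (\<forall>z. v + \<tau> (u, v) * (z - u) \<le> g z)"
      using *[THEN spec, of "(u, v)"] by simp
    with that show ?thesis by blast
  qed
  have "convergent (\<lambda>n. (x n, y n))"
    if bdd: "bdd_below (range (\<lambda>n. y n - \<epsilon> * \<bar>x n\<bar>))"
      and move: "\<And>n. y (Suc n) - y n \<le> \<tau> (x n, y n) * (x (Suc n) - x n)" for x y :: "nat \<Rightarrow> real"
  proof -
    define B where "B g \<longleftrightarrow> (\<exists>n. y n \<le> g (x n))" for g
    have move_le: "y (Suc n) \<le> y n + \<tau> (x n, y n) * (x (Suc n) - x n)" for n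
      using move[of n] by linarith
    have stay: "y m \<le> g (x m)" if "g \<in> G" "y n \<le> g (x n)" "n \<le> m" for g n m
      using that(3)
    proof (induction m rule: dec_induct)
      case (step m)
      with support[OF that(1), of "y m" "x m" "x (Suc m)"] move_le[of m] show ?case by linarith
    qed (rule that(2))
    show ?thesis
    proof (cases "\<exists>s\<in>G. \<exists>N. \<forall>m\<ge>N. y m = s (x m)")
      case True
      then obtain s N where s: "s \<in> G" and eq: "\<And>m. N \<le> m \<Longrightarrow> y m = s (x m)" by blast
      obtain c where c: "0 < c" "adm \<theta> c s" using admG[OF s] by blast
      have const: "x (Suc m) = x m" if "N \<le> m" for m
      proof (rule ccontr)
        \<comment> \<open>The supporting line at \<open>x m\<close> would meet the graph of
          \<open>s\<close> on or below itself at \<open>x (Suc m)\<close>, so \<open>s\<close> at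
          the midpoint could not lie below the chord, against strict convexity.\<close>
        assume ne: "x (Suc m) \<noteq> x m"
        let ?t = "\<tau> (x m, y m)"
        have line: "s (x m) + ?t * (z - x m) \<le> s z" for z
          using support[OF s, of "y m" "x m" z] eq[OF that] by simp
        have "s (x (Suc m)) \<le> s (x m) + ?t * (x (Suc m) - x m)"
          using move_le[of m] eq that by simp
        moreover have "(x (Suc m) + x m) / 2 - x m = (x (Suc m) - x m) / 2"
          by (simp add: field_simps)
        then have "s (x m) + ?t * (x (Suc m) - x m) / 2 \<le> s ((x (Suc m) + x m) / 2)"
          using line[of "(x (Suc m) + x m) / 2"] by simp
        ultimately have "(s (x (Suc m)) + s (x m)) / 2 \<le> s ((x (Suc m) + x m) / 2)"
          by argo
        with adm_midpoint[OF c(2,1) ne] show False by simp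
      qed
      have xN: "x m = x N" if "N \<le> m" for m
        using that by (induction m rule: dec_induct) (simp_all only: const)
      have "(x m, y m) = (x N, y N)" if "N \<le> m" for m
        using xN[OF that] eq[OF that] eq[OF order_refl] by simp
      then have "\<forall>\<^sub>F m in sequentially. (x m, y m) = (x N, y N)"
        unfolding eventually_sequentially by blast
      then have "(\<lambda>m. (x m, y m)) \<longlonglongrightarrow> (x N, y N)" by (rule tendsto_eventually)
      then show ?thesis by (rule convergentI)
    next
      case False
      obtain C where C: "\<And>n. C \<le> y n - \<epsilon> * \<bar>x n\<bar>" using bdd by (auto simp: bdd_below_def)
      \<comment> \<open>Chosen so that \<open>H 0\<close> stays strictly below the sequence; the
        final \<open>- 1\<close> gives strictness.\<close>
      define j where "j = \<lfloor>C - \<theta>\<rfloor> - 1"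
      define H where "H k = (\<lambda>x. \<theta> * hyp x + of_int (j + int k))" for k
      have HG: "H k \<in> G" for k unfolding H_def by (rule baseG)
      have hyp_bound: "\<theta> * hyp z \<le> \<theta> + \<theta> * \<bar>z\<bar>" for z
        using mult_left_mono[OF hyp_le, of \<theta> z] \<theta> by (simp add: algebra_simps)
      have "\<not> B (H 0)"
      proof -
        have "H 0 (x n) < y n" for n
        proof -
          have "\<theta> * \<bar>x n\<bar> \<le> \<epsilon> * \<bar>x n\<bar>" using \<theta> by (intro mult_right_mono) auto
          moreover have "real_of_int j < C - \<theta>" unfolding j_def by linarith
          ultimately show ?thesis using hyp_bound[of "x n"] C[of n] by (simp add: H_def)
        qed
        then show ?thesis by (simp add: B_def not_le)
      qed
      obtain k where k: "y 0 \<le> H k (x 0)"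
      proof -
        obtain k where "y 0 - \<theta> * hyp (x 0) - of_int j \<le> real k" using real_arch_simple by blast
        then show ?thesis by (intro that[of k]) (simp add: H_def)
      qed
      \<comment> \<open>Below \<open>H k\<close> the points grow at rate at most
        \<open>\<theta>\<close> in \<open>\<bar>x n\<bar>\<close>, but the hypothesis demands rate
        \<open>\<epsilon>\<close>; comparing the two bounds \<open>x\<close>.\<close>
      define R where "R = (\<theta> + of_int (j + int k) - C) / (\<epsilon> - \<theta>)"
      have xR: "\<bar>x n\<bar> \<le> R" for n
      proof -
        have "y n \<le> H k (x n)" using stay[OF HG k] by simp
        with hyp_bound[of "x n"] C[of n] have "(\<epsilon> - \<theta>) * \<bar>x n\<bar> \<le> \<theta> + of_int (j + int k) - C"
          by (simp add: H_def algebra_simps)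
        then show ?thesis using \<theta> by (simp add: R_def pos_le_divide_eq mult.commute)
      qed
      have trapped: "\<exists>g g'. (g, g') \<in> P n \<and> \<not> B g \<and> B g'" for n
      proof (induction n)
        case 0
        define l where "l = (LEAST l. B (H l))"
        have "B (H k)" using k by (auto simp: B_def)
        then have l: "B (H l)" unfolding l_def by (rule LeastI)
        then have "l \<noteq> 0" using \<open>\<not> B (H 0)\<close> by metis
        then obtain l' where l': "l = Suc l'" by (cases l) auto
        have "\<not> B (H l')" using not_less_Least[of l' "\<lambda>l. B (H l)"] l' by (simp add: l_def)
        moreover have "(H l', H l) \<in> P 0"
          unfolding P0 H_def l' by (rule range_eqI[of _ _ "j + int l'"]) (simp add: fun_eq_iff)
        ultimately show ?case using l by blast
      next
        case (Suc n)
        then obtain a a' where a: "(a, a') \<in> P n" "B a'" "\<not> B a" by blast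
        \<comment> \<open>The second alternative would put the sequence eventually on the graph of
          \<open>s\<close>: it stays below \<open>s\<close> and is above every member of
          \<open>M\<close>. The current case excludes this.\<close>
        have "\<not> (s \<in> insert a' (fst ` P (Suc n)) \<and> B s \<and> M \<noteq> {} \<and> M \<subseteq> {k \<in> fst ` P (Suc n). \<not> B k} \<and>
              (\<forall>x. s x = (SUP k\<in>M. k x)))" for s M
        proof
          assume "s \<in> insert a' (fst ` P (Suc n)) \<and> B s \<and> M \<noteq> {} \<and> M \<subseteq> {k \<in> fst ` P (Suc n). \<not> B k} \<and>
              (\<forall>x. s x = (SUP k\<in>M. k x))"
          then have s: "s \<in> insert a' (fst ` P (Suc n))" "B s" and M: "M \<noteq> {}" "\<And>k. k \<in> M \<Longrightarrow> \<not> B k"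
            and sup: "\<And>x. s x = (SUP k\<in>M. k x)"
            by auto
          have "s \<in> G" using s(1) PG(2)[OF a(1)] by (auto simp: G_def)
          obtain N where N: "y N \<le> s (x N)" using s(2) by (auto simp: B_def)
          have "s (x m) \<le> y m" for m
            unfolding sup using M by (intro cSUP_least) (auto simp: B_def not_le less_imp_le)
          then have "\<forall>m\<ge>N. y m = s (x m)"
            using stay[OF \<open>s \<in> G\<close> N] by (auto intro: antisym)
          with False \<open>s \<in> G\<close> show False by blast
        qed
        then show ?case using subdivides_exit[OF subdivides, of a a' n B, OF a] by blast
      qed
      have cauchy: "\<exists>N. \<forall>m\<ge>N. \<forall>k\<ge>N. \<bar>x m - x k\<bar> < e \<and> y m - y k < e" if "0 < e" for e
      proof -
        obtain n1 where n1: "1 / real (Suc n1) < e / (1 + \<theta>)"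
          using nat_approx_posE[of "e / (1 + \<theta>)"] \<open>0 < e\<close> \<theta> by auto
        \<comment> \<open>Large enough for the window to contain all \<open>x m\<close> and for the
          tolerance to beat \<open>e / (1 + \<theta>)\<close>.\<close>
        define n where "n = max n1 (nat \<lceil>R\<rceil>)"
        define \<eta> where "\<eta> = 1 / real (Suc n)"
        have "R \<le> real n" unfolding n_def by linarith
        have "\<eta> \<le> 1 / real (Suc n1)" unfolding \<eta>_def n_def by (intro divide_left_mono) auto
        with n1 have "\<eta> < e / (1 + \<theta>)" by linarith
        then have small: "\<eta> + \<theta> * \<eta> < e" using \<theta> by (simp add: pos_less_divide_eq algebra_simps)
        have "0 < \<eta>" by (simp add: \<eta>_def)
        then have "0 < \<theta> * \<eta>" using \<theta> by simp
        obtain g g' where g: "(g, g') \<in> P (Suc n)" "\<not> B g" "B g'" using trapped[of "Suc n"] by blast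
        have close: "close_on (real n) \<eta> g g'"
          unfolding \<eta>_def by (rule subdividesD(1)[OF subdivides g(1)])
        obtain N where N: "y N \<le> g' (x N)" using g(3) by (auto simp: B_def)
        have "\<bar>x m - x k\<bar> < e \<and> y m - y k < e" if "N \<le> m" "N \<le> k" for m k
        proof -
          have lo: "g (x m) < y m" "g (x k) < y k" using g(2) by (auto simp: B_def not_le)
          have hi: "y m \<le> g' (x m)" "y k \<le> g' (x k)"
            using stay[OF PG(2)[OF g(1)] N] that by auto
          have mem: "x m \<in> {-real n..real n}" "x k \<in> {-real n..real n}"
            using xR[of m] xR[of k] \<open>R \<le> real n\<close> by auto
          \<comment> \<open>Since \<open>g < g'\<close> at both \<open>x m\<close> and
            \<open>x k\<close>, these points lie in the short set where the two boundaries
            differ.\<close>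
          have d: "\<bar>x m - x k\<bar> \<le> \<eta>" "g' (x m) - g (x m) \<le> \<eta>"
            using close mem lo hi unfolding close_on_def by fastforce+
          have "g (x m) - g (x k) \<le> \<theta> * \<bar>x m - x k\<bar>" by (rule lipG[OF PG(1)[OF g(1)]])
          also have "\<dots> \<le> \<theta> * \<eta>" using d \<theta> by simp
          finally show ?thesis using d hi lo small \<open>0 < \<theta> * \<eta>\<close> by linarith
        qed
        then show ?thesis by blast
      qed
      have "Cauchy x" unfolding Cauchy_def dist_real_def using cauchy by blast
      moreover have "Cauchy y"
        unfolding Cauchy_def dist_real_def
      proof (intro allI impI)
        fix e :: real assume "0 < e"
        from cauchy[OF this] obtain N where "\<And>m k. N \<le> m \<Longrightarrow> N \<le> k \<Longrightarrow> y m - y k < e" by blast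
        then show "\<exists>N. \<forall>m\<ge>N. \<forall>k\<ge>N. \<bar>y m - y k\<bar> < e"
          by (intro exI[of _ N]) (auto simp: abs_less_iff)
      qed
      ultimately obtain a b where "x \<longlonglongrightarrow> a" "y \<longlonglongrightarrow> b"
        by (meson Cauchy_convergent convergent_def)
      then have "(\<lambda>n. (x n, y n)) \<longlonglongrightarrow> (a, b)" by (rule tendsto_Pair)
      then show ?thesis by (rule convergentI)
    qed
  qed
  then show ?thesis using \<tau> by (intro exI[of _ \<tau>]) auto
qed

end
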